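(* Let $A=(A_1,\dots,A_5):I\to\mathbb{R}^{3\times5}$ be smooth on an open interval $I$, with columns linearly independent over $\mathbb{R}$ (as functions on $I$), such that $$p_{234}=1,\quad p_{123}=p_{345}=p_{235}-p_{134}=0,\quad p_{124}=p_{125}=p_{145}=p_{245}=0,$$ every $Q_{ij}=c_{ij}$ ($1\le i<j\le 5$) is constant, and $c_{14}=c_{13}=c_{23}=c_{34}=c_{35}=0$. Then, up to left multiplication by a constant rotation and multiplication of the columns of $A$ by nonzero constants (preserving the spatial constraints and the conditions above), $$A=\begin{pmatrix}\ell b_{12}&b_{12}&0&0&0\\0&0&b_{12}^{-2}&0&0\\0&0&0&b_{12}&\ell b_{12}\end{pmatrix},\qquad \ell'=\frac{c_{12}}{b_{12}^2}.$$ Conversely, every such $A$ (with $b_{12}$ smooth, nowhere zero and $c_{12}\neq0$ constant) satisfies the conditions above.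
   Context: For $A(t)\in\mathbb{R}^{3\times m}$ with columns $A_i$, set $p_{ijk}=\det(A_i,A_j,A_k)$ and $Q_{ij}=\langle A_i',A_j\rangle-\langle A_j',A_i\rangle$, $'=d/dt$. Origin: $\varphi(z,t)=A(t)v(z)$ is sought as a solution of the 3D incompressible Euler equations in Lagrangian form, with spatial constraints $g_{134}+g_{235}=g_{135}=0$, where $g_{ijk}=\det(\nabla v^i,\nabla v^j,\nabla v^k)$ (parabolic case; $v=(z_1,z_2,z_3,f^1+z_2\,\partial_{z_1}f^2,f^2)$ with $f^j=f^j(z_1,z_3)$). The stated conditions are the normalized constraints on the time component. Rescaling of columns is the operation $(A,v)\mapsto(AH,H^{-1}v)$ with $H$ constant diagonal invertible. Solutions with columns of $A$ linearly dependent over $\mathbb{R}$ are called reducible and discarded. *)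

theory Defs
  imports "HOL-Analysis.Analysis"
begin

text \<open>
  Columns and components are indexed by the numeral types \<open>3\<close> and \<open>5\<close>, whose elements are
  written \<open>1, 2, 3\<close> and \<open>1, \<dots>, 5\<close>.  Pitfall: in type \<open>5\<close> the index \<open>5\<close> is the
  same element as \<open>0\<close>, so the order of that type is not the order of the labels; wherever labels
  are compared they are natural numbers, converted by \<open>of_nat\<close>.
\<close>

text \<open>Infinite differentiability of a curve; meant for open \<open>I\<close>.\<close>

definition smooth_curve_on :: "real set \<Rightarrow> (real \<Rightarrow> 'a::real_normed_vector) \<Rightarrow> bool" where
  "smooth_curve_on I f \<longleftrightarrow>
    (\<forall>n. \<forall>t\<in>I. ((\<lambda>g s. vector_derivative g (at s)) ^^ n) f differentiable (at t))"

definition det3 :: "real^3 \<Rightarrow> real^3 \<Rightarrow> real^3 \<Rightarrow> real" where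
  "det3 a b c = det (transpose (vector [a, b, c] :: real^3^3))"

definition pdet :: "(real \<Rightarrow> real^5^3) \<Rightarrow> 5 \<Rightarrow> 5 \<Rightarrow> 5 \<Rightarrow> real \<Rightarrow> real" where
  "pdet A i j k t = det3 (column i (A t)) (column j (A t)) (column k (A t))"

definition Qform :: "(real \<Rightarrow> real^5^3) \<Rightarrow> 5 \<Rightarrow> 5 \<Rightarrow> real \<Rightarrow> real" where
  "Qform A i j t =
     vector_derivative (\<lambda>s. column i (A s)) (at t) \<bullet> column j (A t)
   - vector_derivative (\<lambda>s. column j (A s)) (at t) \<bullet> column i (A t)"

definition columns_independent_on :: "real set \<Rightarrow> (real \<Rightarrow> real^5^3) \<Rightarrow> bool" where
  "columns_independent_on I A \<longleftrightarrow>
    (\<forall>x :: 5 \<Rightarrow> real.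
       (\<forall>t\<in>I. (\<Sum>i\<in>UNIV. x i *\<^sub>R column i (A t)) = 0) \<longrightarrow> (\<forall>i. x i = 0))"

text \<open>The conditions on the time component; only the values \<open>c i j\<close> with
  \<open>1 \<le> i < j \<le> 5\<close> matter.\<close>

definition time_conditions ::
    "real set \<Rightarrow> (real \<Rightarrow> real^5^3) \<Rightarrow> (nat \<Rightarrow> nat \<Rightarrow> real) \<Rightarrow> bool" where
  "time_conditions I A c \<longleftrightarrow>
     smooth_curve_on I A \<and>
     columns_independent_on I A \<and>
     (\<forall>t\<in>I. pdet A 2 3 4 t = 1 \<and>
        pdet A 1 2 3 t = 0 \<and> pdet A 3 4 5 t = 0 \<and> pdet A 2 3 5 t - pdet A 1 3 4 t = 0 \<and>
        pdet A 1 2 4 t = 0 \<and> pdet A 1 2 5 t = 0 \<and> pdet A 1 4 5 t = 0 \<and> pdet A 2 4 5 t = 0) \<and>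
     (\<forall>i j. 1 \<le> i \<and> i < j \<and> j \<le> 5 \<longrightarrow> (\<forall>t\<in>I. Qform A (of_nat i) (of_nat j) t = c i j)) \<and>
     c 1 4 = 0 \<and> c 1 3 = 0 \<and> c 2 3 = 0 \<and> c 3 4 = 0 \<and> c 3 5 = 0"

definition grad :: "(real^3 \<Rightarrow> real) \<Rightarrow> real^3 \<Rightarrow> real^3" where
  "grad f z = (\<chi> i. frechet_derivative f (at z) (axis i 1))"

definition gdet :: "(real^3 \<Rightarrow> real^5) \<Rightarrow> 5 \<Rightarrow> 5 \<Rightarrow> 5 \<Rightarrow> real^3 \<Rightarrow> real" where
  "gdet v i j k z = det3 (grad (\<lambda>y. v y $ i) z) (grad (\<lambda>y. v y $ j) z) (grad (\<lambda>y. v y $ k) z)"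

definition spatial_constraints :: "(real^3) set \<Rightarrow> (real^3 \<Rightarrow> real^5) \<Rightarrow> bool" where
  "spatial_constraints U v \<longleftrightarrow>
     v differentiable_on U \<and> (\<forall>z\<in>U. gdet v 1 3 4 z + gdet v 2 3 5 z = 0 \<and> gdet v 1 3 5 z = 0)"

definition diagonal :: "real^'n^'n \<Rightarrow> bool" where
  "diagonal H \<longleftrightarrow> (\<forall>i j. i \<noteq> j \<longrightarrow> H $ i $ j = 0)"

text \<open>The matrix \<open>H\<close> acts by \<open>(A, v) \<mapsto> (A H, H\<^sup>-\<^sup>1 v)\<close>.\<close>

definition preserves_spatial_constraints :: "real^5^5 \<Rightarrow> bool" where
  "preserves_spatial_constraints H \<longleftrightarrow>
    (\<forall>U v. open U \<and> spatial_constraints U v \<longrightarrow>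
       spatial_constraints U (\<lambda>z. matrix_inv H *v v z))"

definition normal_matrix :: "real \<Rightarrow> real \<Rightarrow> real^5^3" where
  "normal_matrix b l = vector
     [vector [l * b, b, 0,              0, 0    ],
      vector [0,     0, inverse (b\<^sup>2), 0, 0    ],
      vector [0,     0, 0,              b, l * b]]"

text \<open>Here \<open>b\<close>, \<open>l\<close>, \<open>d\<close> are the function \<open>b\<^sub>1\<^sub>2\<close>, the function
  \<open>\<ell>\<close> and the constant \<open>c\<^sub>1\<^sub>2\<close>.\<close>

definition normal_form ::
    "real set \<Rightarrow> (real \<Rightarrow> real) \<Rightarrow> (real \<Rightarrow> real) \<Rightarrow> real \<Rightarrow> (real \<Rightarrow> real^5^3) \<Rightarrow> bool" where
  "normal_form I b l d A \<longleftrightarrow>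
     smooth_curve_on I b \<and> (\<forall>t\<in>I. b t \<noteq> 0) \<and> d \<noteq> 0 \<and>
     (\<forall>t\<in>I. (l has_real_derivative d / (b t)\<^sup>2) (at t)) \<and>
     (\<forall>t\<in>I. A t = normal_matrix (b t) (l t))"

end

theory Submission
  imports Defs
begin

text \<open>
  The condition \<open>p\<^sub>2\<^sub>3\<^sub>4 = 1\<close> makes \<open>A\<^sub>2, A\<^sub>3, A\<^sub>4\<close>
  a frame of space at every time.  By Cramer's rule the other determinant conditions say exactly that
  \<open>A\<^sub>1 = \<ell> A\<^sub>2\<close> and \<open>A\<^sub>5 = \<ell> A\<^sub>4\<close> with the same function
  \<open>\<ell> = p\<^sub>1\<^sub>3\<^sub>4\<close> (\<open>multiplier_of_determinants\<close>), and linear independence of the columns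
  says that \<open>\<ell>\<close> is not constant.

  Under this substitution \<open>c\<^sub>1\<^sub>2 = \<ell>' |A\<^sub>2|\<^sup>2\<close>, so \<open>c\<^sub>1\<^sub>2 \<noteq> 0\<close> and \<open>\<ell>'\<close> has
  no zero; the remaining conditions on the \<open>Q\<^sub>i\<^sub>j\<close> then force \<open>A\<^sub>2, A\<^sub>3, A\<^sub>4\<close> to be
  pairwise orthogonal, with all three forms \<open>Q\<^sub>2\<^sub>3, Q\<^sub>2\<^sub>4, Q\<^sub>3\<^sub>4\<close> equal to zero
  (\<open>time_conditions_imp_orthogonal\<close>).  For orthogonal curves a vanishing \<open>Q\<^sub>i\<^sub>j\<close> means
  that neither derivative has a component along the other curve.  So none of the three columns turns:
  each keeps a constant direction and only its length varies (\<open>constant_directions\<close>).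

  A constant rotation moves these directions to the coordinate axes.  Also
  \<open>c\<^sub>4\<^sub>5 = - \<ell>' |A\<^sub>4|\<^sup>2\<close>, so the lengths of \<open>A\<^sub>4\<close> and \<open>A\<^sub>2\<close> have a constant
  ratio \<open>k\<close>, and the length of \<open>A\<^sub>3\<close> follows from \<open>p\<^sub>2\<^sub>3\<^sub>4 = 1\<close>.  Multiplying the
  columns by \<open>1, 1, k, 1/k, 1/k\<close> produces the normal form with \<open>b = |A\<^sub>2|\<close>
  (\<open>time_conditions_imp_normal_form\<close>), and this rescaling respects the spatial constraints because
  the factors of columns 1 and 4 have the same product as those of columns 2 and 5.

  The converse is a direct computation (\<open>normal_form_imp_time_conditions\<close>).  It also supplies the
  conditions for the rescaled matrix in the first half.
\<close>

section \<open>Vectors with five components\<close>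

lemma exhaust_5:
  fixes x :: 5
  shows "x = 1 \<or> x = 2 \<or> x = 3 \<or> x = 4 \<or> x = 5"
proof (induct x)
  case (of_int z)
  then have "z = 0 \<or> z = 1 \<or> z = 2 \<or> z = 3 \<or> z = 4" by fastforce
  then show ?case by auto
qed

lemma forall_5: "(\<forall>i::5. P i) \<longleftrightarrow> P 1 \<and> P 2 \<and> P 3 \<and> P 4 \<and> P 5"
  by (metis exhaust_5)

lemma UNIV_5: "UNIV = {1, 2, 3, 4, 5::5}"
  using exhaust_5 by auto

lemma sum_5: "sum f (UNIV::5 set) = f 1 + f 2 + f 3 + f 4 + f 5"
  unfolding UNIV_5 by (simp add: ac_simps)

lemma vector_5 [simp]:
  "(vector [u, v, w, x, y] :: ('a::zero)^5) $ 1 = u"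
  "(vector [u, v, w, x, y] :: ('a::zero)^5) $ 2 = v"
  "(vector [u, v, w, x, y] :: ('a::zero)^5) $ 3 = w"
  "(vector [u, v, w, x, y] :: ('a::zero)^5) $ 4 = x"
  "(vector [u, v, w, x, y] :: ('a::zero)^5) $ 5 = y"
  unfolding vector_def by simp_all

section \<open>Smooth curves\<close>

text \<open>
  The iterates of \<^const>\<open>vector_derivative\<close> are awkward for products and quotients: the
  calculus rules describe them on \<open>I\<close> only, so each further derivative requires a change of
  function near a point.  The recursion instead lets a proof name any function that is a derivative on
  \<open>I\<close>, and the closure properties become inductions on the order in which the calculus rule
  supplies that function.
\<close>

primrec diff_order :: "real set \<Rightarrow> nat \<Rightarrow> (real \<Rightarrow> 'a::real_normed_vector) \<Rightarrow> bool" where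
  "diff_order I 0 f \<longleftrightarrow> True"
| "diff_order I (Suc n) f \<longleftrightarrow>
     (\<exists>g. (\<forall>t\<in>I. (f has_vector_derivative g t) (at t)) \<and> diff_order I n g)"

lemma diff_order_SucI:
  assumes "\<And>t. t \<in> I \<Longrightarrow> (f has_vector_derivative g t) (at t)" "diff_order I n g"
  shows "diff_order I (Suc n) f"
  unfolding diff_order.simps using assms by (intro exI[of _ g]) blast

lemma diff_order_cong:
  assumes "open I" "\<And>t. t \<in> I \<Longrightarrow> f t = g t" "diff_order I n f"
  shows "diff_order I n g"
proof (cases n)
  case (Suc m)
  with assms(3) obtain h where h: "\<forall>t\<in>I. (f has_vector_derivative h t) (at t)" "diff_order I m h"
    by auto
  have "\<forall>t\<in>I. (g has_vector_derivative h t) (at t)"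
    using has_vector_derivative_transform_within_open[OF _ \<open>open I\<close>] assms(2) h(1) by blast
  with h(2) Suc show ?thesis by auto
qed simp

lemma smooth_curve_on_iff_diff_order:
  assumes "open I"
  shows "smooth_curve_on I f \<longleftrightarrow> (\<forall>n. diff_order I n f)"
proof
  let ?D = "\<lambda>g s. vector_derivative g (at s :: real filter)"
  assume f: "smooth_curve_on I f"
  have "diff_order I n ((?D ^^ k) f)" for n k
  proof (induction n arbitrary: k)
    case (Suc n)
    have "((?D ^^ k) f has_vector_derivative (?D ^^ Suc k) f t) (at t)" if "t \<in> I" for t
      using f that vector_derivative_works unfolding smooth_curve_on_def by auto
    with Suc[of "Suc k"] show ?case
      unfolding diff_order.simps by blast
  qed simp
  from this[of _ 0] show "\<forall>n. diff_order I n f" by simp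
next
  let ?D = "\<lambda>g s. vector_derivative g (at s :: real filter)"
  have "\<forall>t\<in>I. (?D ^^ n) f differentiable (at t)" if "diff_order I (Suc n) f" for n
    using that
  proof (induction n arbitrary: f)
    case 0
    then show ?case by (auto intro: differentiableI_vector)
  next
    case (Suc n)
    then obtain g where g: "\<forall>t\<in>I. (f has_vector_derivative g t) (at t)" "diff_order I (Suc n) g"
      by auto
    \<comment> \<open>The recursion may have named any derivative of \<open>f\<close>; on \<open>I\<close> it is this one.\<close>
    have "diff_order I (Suc n) (?D f)"
      by (rule diff_order_cong[OF assms _ g(2)]) (use g(1) in \<open>auto simp: vector_derivative_at\<close>)
    from Suc.IH[OF this] show ?case
      by (simp only: funpow_Suc_right o_def)
  qed
  then show "smooth_curve_on I f" if "\<forall>n. diff_order I n f"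
    using that unfolding smooth_curve_on_def by blast
qed

lemma diff_order_Suc_imp: "diff_order I (Suc n) f \<Longrightarrow> diff_order I n f"
proof (induction n arbitrary: f)
  case (Suc n)
  then obtain g where "\<forall>t\<in>I. (f has_vector_derivative g t) (at t)" "diff_order I n g"
    by (metis diff_order.simps(2))
  then show ?case
    unfolding diff_order.simps by blast
qed simp

lemma diff_order_add:
  "diff_order I n f \<Longrightarrow> diff_order I n g \<Longrightarrow> diff_order I n (\<lambda>t. f t + g t)"
proof (induction n arbitrary: f g)
  case (Suc n)
  from Suc.prems obtain f' g'
    where "\<forall>t\<in>I. (f has_vector_derivative f' t) (at t)" "diff_order I n f'"
      "\<forall>t\<in>I. (g has_vector_derivative g' t) (at t)" "diff_order I n g'"
    by auto
  with Suc.IH[of f' g'] show ?case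
    by (auto intro!: exI[of _ "\<lambda>t. f' t + g' t"] has_vector_derivative_add)
qed simp

lemma diff_order_bounded_linear:
  assumes "bounded_linear L"
  shows "diff_order I n f \<Longrightarrow> diff_order I n (\<lambda>t. L (f t))"
proof (induction n arbitrary: f)
  case (Suc n)
  from Suc.prems obtain f'
    where "\<forall>t\<in>I. (f has_vector_derivative f' t) (at t)" "diff_order I n f'"
    by auto
  with Suc.IH[of f'] bounded_linear.has_vector_derivative[OF assms] show ?case
    by (auto intro!: exI[of _ "\<lambda>t. L (f' t)"])
qed simp

lemma diff_order_mult:
  fixes f g :: "real \<Rightarrow> real"
  shows "diff_order I n f \<Longrightarrow> diff_order I n g \<Longrightarrow> diff_order I n (\<lambda>t. f t * g t)"
proof (induction n arbitrary: f g)
  case (Suc n)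
  from Suc.prems obtain f' g'
    where d: "\<forall>t\<in>I. (f has_vector_derivative f' t) (at t)" "diff_order I n f'"
      "\<forall>t\<in>I. (g has_vector_derivative g' t) (at t)" "diff_order I n g'"
    by auto
  have "diff_order I n (\<lambda>t. f t * g' t + f' t * g t)"
    using Suc d diff_order_Suc_imp by (intro diff_order_add Suc.IH) blast+
  with d show ?case
    by (auto intro!: exI[of _ "\<lambda>t. f t * g' t + f' t * g t"] has_vector_derivative_mult)
qed simp

text \<open>
  The derivative of \<open>1 / f\<close> contains \<open>1 / f\<close> itself, but only one order of
  differentiability is asked of it there, so the induction closes.
\<close>

lemma diff_order_inverse:
  fixes f :: "real \<Rightarrow> real"
  assumes "\<forall>t\<in>I. f t \<noteq> 0"
  shows "diff_order I n f \<Longrightarrow> diff_order I n (\<lambda>t. inverse (f t))"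
proof (induction n)
  case (Suc n)
  from Suc.prems obtain f'
    where d: "\<forall>t\<in>I. (f has_vector_derivative f' t) (at t)" "diff_order I n f'"
    by auto
  let ?g = "\<lambda>t. - (inverse (f t) * f' t * inverse (f t))"
  have "diff_order I n (\<lambda>t. inverse (f t))"
    using Suc diff_order_Suc_imp by blast
  then have "diff_order I n ?g"
    using d(2) by (intro diff_order_bounded_linear[OF bounded_linear_minus[OF bounded_linear_ident]]
        diff_order_mult)
  moreover have "\<forall>t\<in>I. ((\<lambda>t. inverse (f t)) has_vector_derivative ?g t) (at t)"
  proof
    fix t assume t: "t \<in> I"
    then have "(f has_real_derivative f' t) (at t)"
      using d(1) by (simp add: has_real_derivative_iff_has_vector_derivative)
    from DERIV_inverse'[OF this] assms t
    show "((\<lambda>t. inverse (f t)) has_vector_derivative ?g t) (at t)"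
      unfolding has_real_derivative_iff_has_vector_derivative by blast
  qed
  ultimately show ?case
    unfolding diff_order.simps by (intro exI[of _ ?g] conjI)
qed simp

section \<open>Linear algebra in three dimensions\<close>

lemma bounded_linear_column: "bounded_linear (column j :: real^'n^'m \<Rightarrow> real^'m)"
  by (rule linear_conv_bounded_linear[THEN iffD1]) (auto simp: linear_iff column_def vec_eq_iff)

lemma det3_expand:
  "det3 a b c = a$1 * b$2 * c$3 + b$1 * c$2 * a$3 + c$1 * a$2 * b$3
     - a$1 * c$2 * b$3 - b$1 * a$2 * c$3 - c$1 * b$2 * a$3"
  by (simp add: det3_def det_3 transpose_def)

lemma cramer_det3:
  "det3 u v w *\<^sub>R x = det3 x v w *\<^sub>R u + det3 u x w *\<^sub>R v + det3 u v x *\<^sub>R w"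
  by (simp add: vec_eq_iff forall_3 det3_expand algebra_simps)

lemma det3_scaleR: "det3 (p *\<^sub>R a) (q *\<^sub>R b) (r *\<^sub>R c) = p * q * r * det3 a b c"
  by (simp add: det3_expand algebra_simps)

text \<open>
  Subtracting from \<open>x\<close> its projection to \<open>u\<close> leaves a vector orthogonal to all of
  \<open>u\<close>, \<open>v\<close>, \<open>w\<close>; by Cramer's rule it is a combination of them, hence orthogonal to
  itself.
\<close>

lemma orthogonal_to_two_frame_vectors:
  assumes "det3 u v w \<noteq> 0" "u \<bullet> v = 0" "u \<bullet> w = 0" "x \<bullet> v = 0" "x \<bullet> w = 0"
  shows "x = ((x \<bullet> u) / (u \<bullet> u)) *\<^sub>R u"
proof -
  define y where "y = x - ((x \<bullet> u) / (u \<bullet> u)) *\<^sub>R u"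
  have "u \<noteq> 0"
    using assms(1) by (auto simp: det3_expand)
  then have "y \<bullet> u = 0" "y \<bullet> v = 0" "y \<bullet> w = 0"
    using assms by (auto simp: y_def inner_diff_left inner_diff_right)
  then have "y \<bullet> (det3 u v w *\<^sub>R y) = 0"
    by (subst cramer_det3) (simp add: inner_add_right)
  then show ?thesis
    using assms(1) by (simp add: y_def)
qed

text \<open>
  The normalized frame is an orthogonal matrix, whose determinant can only be \<open>1\<close> or
  \<open>-1\<close>; the orientation of the frame decides for \<open>1\<close>, and pulling the lengths out of the
  determinant gives the volume of the box.
\<close>

lemma rotation_matrix_of_orthogonal_frame:
  assumes "det3 u v w > 0" "u \<bullet> v = 0" "u \<bullet> w = 0" "v \<bullet> w = 0"
  shows "rotation_matrix (vector [sgn u, sgn v, sgn w] :: real^3^3)" (is "rotation_matrix ?R")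
    and "det3 u v w = norm u * norm v * norm w"
proof -
  have nz: "u \<noteq> 0" "v \<noteq> 0" "w \<noteq> 0"
    using assms(1) by (auto simp: det3_expand)
  have R: "orthogonal_matrix ?R"
    unfolding orthogonal_matrix_orthonormal_rows
    using assms(2-4) nz
    by (auto simp: forall_3 row_def orthogonal_def vec_nth_inverse norm_sgn sgn_div_norm inner_commute)
  have D: "det ?R = det3 (sgn u) (sgn v) (sgn w)"
    by (simp add: det3_def det_transpose)
  have "det3 u v w = det3 (norm u *\<^sub>R sgn u) (norm v *\<^sub>R sgn v) (norm w *\<^sub>R sgn w)"
    using nz by (simp add: sgn_div_norm)
  also have "\<dots> = norm u * norm v * norm w * det ?R"
    by (simp only: det3_scaleR D)
  finally have eq: "det3 u v w = norm u * norm v * norm w * det ?R" .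
  with assms(1) have "0 < norm u * norm v * norm w * det ?R"
    by simp
  moreover have "0 < norm u * norm v * norm w"
    using nz by simp
  ultimately have "det ?R > 0"
    by (rule zero_less_mult_pos)
  with det_orthogonal_matrix[OF R] have "det ?R = 1"
    by auto
  with R eq show "rotation_matrix ?R" "det3 u v w = norm u * norm v * norm w"
    by (simp_all add: rotation_matrix_def)
qed

text \<open>
  Expand \<open>a1\<close> and \<open>a5\<close> in the basis \<open>a2, a3, a4\<close> by Cramer's rule: the coefficients
  are, up to sign, the given determinants, and only one of them survives for each vector.  The two
  survivors coincide because of the relation \<open>p\<^sub>2\<^sub>3\<^sub>5 = p\<^sub>1\<^sub>3\<^sub>4\<close>.
\<close>

lemma multiplier_of_determinants:
  assumes "det3 a2 a3 a4 = 1" "det3 a1 a2 a3 = 0" "det3 a3 a4 a5 = 0"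
    and "det3 a2 a3 a5 = det3 a1 a3 a4" "det3 a1 a2 a4 = 0" "det3 a2 a4 a5 = 0"
  shows "a1 = det3 a1 a3 a4 *\<^sub>R a2" "a5 = det3 a1 a3 a4 *\<^sub>R a4"
proof -
  have "det3 a2 a1 a4 = - det3 a1 a2 a4" "det3 a2 a3 a1 = det3 a1 a2 a3"
    "det3 a5 a3 a4 = det3 a3 a4 a5" "det3 a2 a5 a4 = - det3 a2 a4 a5"
    by (simp_all add: det3_expand)
  with cramer_det3[of a2 a3 a4 a1] cramer_det3[of a2 a3 a4 a5] assms
  show "a1 = det3 a1 a3 a4 *\<^sub>R a2" "a5 = det3 a1 a3 a4 *\<^sub>R a4"
    by simp_all
qed

section \<open>Curves with constant direction\<close>

text \<open>
  If \<open>u' = m u\<close>, then \<open>|u|' = m |u|\<close>, and the two logarithmic derivatives cancel in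
  \<open>u / |u|\<close>.
\<close>

lemma constant_direction:
  fixes u :: "real \<Rightarrow> 'a::real_inner"
  assumes "convex I"
    and u: "\<And>t. t \<in> I \<Longrightarrow> (u has_vector_derivative m t *\<^sub>R u t) (at t)"
    and nz: "\<And>t. t \<in> I \<Longrightarrow> u t \<noteq> 0"
  obtains e where "\<And>t. t \<in> I \<Longrightarrow> sgn (u t) = e"
proof -
  have "((\<lambda>s. sgn (u s)) has_vector_derivative 0) (at t within I)" if t: "t \<in> I" for t
  proof -
    have "((\<lambda>s. norm (u s)) has_derivative (\<lambda>h. (h *\<^sub>R m t *\<^sub>R u t) \<bullet> sgn (u t))) (at t)"
      using has_derivative_compose[OF u[OF t, unfolded has_vector_derivative_def] has_derivative_norm[OF nz[OF t]]]
      by (simp add: inner_commute)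
    moreover have "(h *\<^sub>R m t *\<^sub>R u t) \<bullet> sgn (u t) = m t * norm (u t) * h" for h
      using nz[OF t] by (simp add: sgn_div_norm power2_norm_eq_inner[symmetric] power2_eq_square)
    ultimately have n: "((\<lambda>s. norm (u s)) has_real_derivative m t * norm (u t)) (at t)"
      unfolding has_field_derivative_def by (metis (no_types, lifting) ext)
    have "((\<lambda>s. inverse (norm (u s))) has_real_derivative - (inverse (norm (u t)) * (m t * norm (u t)) * inverse (norm (u t)))) (at t)"
      using nz[OF t] by (intro DERIV_inverse'[OF n]) simp
    from has_vector_derivative_scaleR[OF this u[OF t]]
    have "((\<lambda>s. sgn (u s)) has_vector_derivative 0) (at t)"
      using nz[OF t] by (simp add: sgn_div_norm field_simps)
    then show "((\<lambda>s. sgn (u s)) has_vector_derivative 0) (at t within I)"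
      by (rule has_vector_derivative_at_within)
  qed
  then show ?thesis
    using has_vector_derivative_zero_constant[OF \<open>convex I\<close>] that by metis
qed

text \<open>
  Differentiating \<open>\<langle>u, v\<rangle> = 0\<close> gives the sum of the two numbers
  \<open>\<langle>u', v\<rangle>\<close> and \<open>\<langle>v', u\<rangle>\<close>; the vanishing of the form \<open>Q\<close> gives
  their difference.
\<close>

lemma orthogonal_curves_derivatives:
  fixes u v :: "real \<Rightarrow> 'a::real_inner"
  assumes "open I" "t \<in> I" and orth: "\<And>s. s \<in> I \<Longrightarrow> u s \<bullet> v s = 0"
    and u: "(u has_vector_derivative p) (at t)" and v: "(v has_vector_derivative q) (at t)"
    and Q: "p \<bullet> v t - q \<bullet> u t = 0"
  shows "p \<bullet> v t = 0" "q \<bullet> u t = 0"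
proof -
  have "((\<lambda>s. u s \<bullet> v s) has_vector_derivative u t \<bullet> q + p \<bullet> v t) (at t)"
    using bounded_bilinear.has_vector_derivative[OF bounded_bilinear_inner u v] .
  moreover have "((\<lambda>s. u s \<bullet> v s) has_vector_derivative 0) (at t)"
    by (rule has_vector_derivative_transform_within_open[OF has_vector_derivative_const[of 0] assms(1,2)])
      (simp add: orth)
  ultimately have "u t \<bullet> q + p \<bullet> v t = 0"
    by (rule vector_derivative_unique_at)
  with Q show "p \<bullet> v t = 0" "q \<bullet> u t = 0"
    by (simp_all add: inner_commute)
qed

section \<open>Column rescalings\<close>

definition diag_matrix :: "('n \<Rightarrow> real) \<Rightarrow> real^'n^'n" where
  "diag_matrix h = (\<chi> i j. if i = j then h i else 0)"

lemma diagonal_diag_matrix: "diagonal (diag_matrix h)"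
  by (simp add: diagonal_def diag_matrix_def)

lemma diag_matrix_mult_vector: "(diag_matrix h *v x) $ i = h i * x $ i"
  by (simp add: diag_matrix_def matrix_vector_mult_def if_distrib if_distribR cong: if_cong)

lemma mult_diag_matrix: "(M ** diag_matrix h) $ i $ j = M $ i $ j * h j"
  by (simp add: diag_matrix_def matrix_matrix_mult_def if_distrib cong: if_cong)

lemma diag_matrix_inverse:
  fixes h :: "'n::finite \<Rightarrow> real"
  assumes "\<And>i. h i \<noteq> 0"
  shows "invertible (diag_matrix h)"
    and "matrix_inv (diag_matrix h) = diag_matrix (\<lambda>i. inverse (h i))"
proof -
  let ?H = "diag_matrix h" and ?K = "diag_matrix (\<lambda>i. inverse (h i))"
  have 1: "?H ** ?K = mat 1" "?K ** ?H = mat 1"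
    using assms by (auto simp: vec_eq_iff mult_diag_matrix) (auto simp: diag_matrix_def mat_def)
  then show inv: "invertible ?H"
    unfolding invertible_def by blast
  have 2: "?H ** matrix_inv ?H = mat 1" "matrix_inv ?H ** ?H = mat 1"
    using someI_ex[OF inv[unfolded invertible_def]] unfolding matrix_inv_def by auto
  show "matrix_inv ?H = ?K"
    by (metis 1(1) 2(2) matrix_mul_assoc matrix_mul_lid matrix_mul_rid)
qed

lemma bounded_linear_differentiable:
  "bounded_linear L \<Longrightarrow> f differentiable F \<Longrightarrow> (\<lambda>x. L (f x)) differentiable F"
  unfolding differentiable_def by (blast intro: bounded_linear.has_derivative)

text \<open>
  Each \<open>g\<^sub>i\<^sub>j\<^sub>k\<close> is divided by \<open>h\<^sub>i h\<^sub>j h\<^sub>k\<close>.  The only constraint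
  with two terms is \<open>g\<^sub>1\<^sub>3\<^sub>4 + g\<^sub>2\<^sub>3\<^sub>5\<close>, so it is enough that both of its terms
  receive the same factor.
\<close>

lemma diagonal_rescaling_preserves_spatial_constraints:
  assumes nz: "\<And>i. h i \<noteq> 0" and eq: "h 1 * h 4 = h 2 * h 5"
  shows "preserves_spatial_constraints (diag_matrix h)"
  unfolding preserves_spatial_constraints_def
proof (intro allI impI, elim conjE)
  fix U :: "(real^3) set" and v :: "real^3 \<Rightarrow> real^5"
  assume "open U" and v: "spatial_constraints U v"
  define k where "k i = inverse (h i)" for i
  define w where "w z = matrix_inv (diag_matrix h) *v v z" for z
  have w: "w z $ i = k i * v z $ i" for z i
    unfolding w_def k_def diag_matrix_inverse(2)[OF nz] by (rule diag_matrix_mult_vector)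
  have vd: "v differentiable at z" if "z \<in> U" for z
    using v that at_within_open[OF that \<open>open U\<close>]
    unfolding spatial_constraints_def differentiable_on_def by metis
  have "w differentiable_on U"
    using v unfolding w_def spatial_constraints_def
    unfolding differentiable_on_def
    by (blast intro: bounded_linear_differentiable matrix_vector_mul_bounded_linear)
  moreover have grad: "grad (\<lambda>y. w y $ i) z = k i *\<^sub>R grad (\<lambda>y. v y $ i) z" if "z \<in> U" for i z
  proof -
    let ?D = "frechet_derivative (\<lambda>y. v y $ i) (at z)"
    have "(\<lambda>y. v y $ i) differentiable at z"
      by (rule bounded_linear_differentiable[OF bounded_linear_vec_nth vd[OF that]])
    then have "((\<lambda>y. v y $ i) has_derivative ?D) (at z)"
      by (simp add: frechet_derivative_works)
    then have "((\<lambda>y. k i * v y $ i) has_derivative (\<lambda>x. k i * ?D x)) (at z)"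
      by (rule has_derivative_mult_right)
    then have "frechet_derivative (\<lambda>y. k i * v y $ i) (at z) = (\<lambda>x. k i * ?D x)"
      by (rule frechet_derivative_at[symmetric])
    then show ?thesis
      by (simp add: grad_def w vec_eq_iff)
  qed
  moreover have "gdet w i j l z = k i * k j * k l * gdet v i j l z" if "z \<in> U" for i j l z
    using that by (simp add: gdet_def grad det3_scaleR)
  moreover have "k 1 * k 4 = k 2 * k 5"
    using eq by (simp add: k_def flip: inverse_mult_distrib)
  then have "k 1 * k 3 * k 4 * x + k 2 * k 3 * k 5 * y = k 3 * (k 1 * k 4) * (x + y)" for x y
    by (simp add: algebra_simps)
  ultimately have "spatial_constraints U w"
    using v by (simp add: spatial_constraints_def)
  then show "spatial_constraints U (\<lambda>z. matrix_inv (diag_matrix h) *v v z)"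
    by (simp add: w_def[abs_def])
qed

section \<open>The normal form satisfies the conditions\<close>

lemma Qform_at:
  assumes "((\<lambda>s. column i (A s)) has_vector_derivative p) (at t)"
    and "((\<lambda>s. column j (A s)) has_vector_derivative q) (at t)"
  shows "Qform A i j t = p \<bullet> column j (A t) - q \<bullet> column i (A t)"
  unfolding Qform_def vector_derivative_at[OF assms(1)] vector_derivative_at[OF assms(2)] ..

text \<open>
  All columns of the normal form move along coordinate axes, so their \<open>Q\<^sub>i\<^sub>j\<close> is a
  Wronskian of the two amplitudes when the axes agree, and zero otherwise.
\<close>

lemma Qform_axis_columns:
  assumes "open I" "t \<in> I"
    and col: "\<And>s i. s \<in> I \<Longrightarrow> column i (A s) = f i s *\<^sub>R axis (\<rho> i) 1"
    and f': "\<And>i. (f i has_real_derivative f' i) (at t)"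
  shows "Qform A i j t = (if \<rho> i = \<rho> j then f' i * f j t - f' j * f i t else 0)"
proof -
  have "((\<lambda>s. column i (A s)) has_vector_derivative f' i *\<^sub>R axis (\<rho> i) 1) (at t)" for i
  proof (rule has_vector_derivative_transform_within_open[OF _ assms(1,2)])
    show "((\<lambda>s. f i s *\<^sub>R axis (\<rho> i) 1) has_vector_derivative f' i *\<^sub>R axis (\<rho> i) 1) (at t)"
      using has_vector_derivative_scaleR[OF f'[of i] has_vector_derivative_const[of "axis (\<rho> i) 1"]] by simp
  qed (simp add: col)
  from Qform_at[OF this this] show ?thesis
    using assms(2) by (simp add: col inner_axis_axis)
qed

text \<open>
  The differential equation for \<open>l\<close> gives it one order of differentiability more than
  \<open>1 / b\<^sup>2\<close>, so it is smooth because \<open>b\<close> is.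
\<close>

lemma smooth_normal_matrix:
  assumes "open I" and b: "smooth_curve_on I b" and nz: "\<forall>t\<in>I. b t \<noteq> 0"
    and l: "\<forall>t\<in>I. (l has_real_derivative d / (b t)\<^sup>2) (at t)"
    and A: "\<And>t. t \<in> I \<Longrightarrow> A t = normal_matrix (b t) (l t)"
  shows "smooth_curve_on I A"
proof -
  have B: "diff_order I n b" for n
    using b smooth_curve_on_iff_diff_order[OF \<open>open I\<close>] by blast
  have V: "diff_order I n (\<lambda>t. inverse ((b t)\<^sup>2))" for n
    using diff_order_inverse[OF _ diff_order_mult[OF B B]] nz by (simp add: power2_eq_square)
  have L: "diff_order I n l" for n
  proof (cases n)
    case (Suc m)
    have "diff_order I m (\<lambda>t. d * inverse ((b t)\<^sup>2))"
      by (intro diff_order_bounded_linear[OF bounded_linear_mult_right] V)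
    moreover have "(l has_vector_derivative d * inverse ((b t)\<^sup>2)) (at t)" if "t \<in> I" for t
      using l that by (simp add: has_real_derivative_iff_has_vector_derivative divide_inverse)
    ultimately show ?thesis
      unfolding Suc by (rule diff_order_SucI[rotated])
  qed simp
  \<comment> \<open>The matrix depends linearly on the three amplitudes \<open>l * b\<close>, \<open>b\<close> and \<open>1 / b\<^sup>2\<close>.\<close>
  let ?M1 = "vector [vector [1, 0, 0, 0, 0], 0, vector [0, 0, 0, 0, 1]] :: real^5^3"
  let ?M2 = "vector [vector [0, 1, 0, 0, 0], 0, vector [0, 0, 0, 1, 0]] :: real^5^3"
  let ?M3 = "vector [0, vector [0, 0, 1, 0, 0], 0] :: real^5^3"
  have "diff_order I n (\<lambda>t. (l t * b t) *\<^sub>R ?M1 + b t *\<^sub>R ?M2 + inverse ((b t)\<^sup>2) *\<^sub>R ?M3)" for n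
    by (intro diff_order_add diff_order_bounded_linear[OF bounded_linear_scaleR_left]
        diff_order_mult[OF L B] B V)
  then have "diff_order I n A" for n
    by (rule diff_order_cong[OF \<open>open I\<close>, rotated])
      (simp add: A normal_matrix_def vec_eq_iff forall_3 forall_5)
  then show ?thesis
    by (simp add: smooth_curve_on_iff_diff_order[OF \<open>open I\<close>])
qed

text \<open>
  Columns 1 and 2 share an axis, as do columns 4 and 5.  The two corresponding Wronskians are
  \<open>l' b\<^sup>2 = d\<close> and \<open>- l' b\<^sup>2 = - d\<close>; every other \<open>Q\<^sub>i\<^sub>j\<close> is zero.  A linear
  relation between the columns splits along the axes; since no amplitude vanishes, a nontrivial part
  must relate columns 1 and 2, or 4 and 5, and would force \<open>l\<close> to be constant, against
  \<open>d \<noteq> 0\<close>.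
\<close>

lemma normal_form_imp_time_conditions:
  assumes "open I" "I \<noteq> {}" and N: "normal_form I b l d A"
  shows "\<exists>c. c 1 2 = d \<and> time_conditions I A c"
proof -
  have b: "smooth_curve_on I b" and nz: "\<forall>t\<in>I. b t \<noteq> 0" and "d \<noteq> 0"
    and l: "\<forall>t\<in>I. (l has_real_derivative d / (b t)\<^sup>2) (at t)"
    and A: "\<And>t. t \<in> I \<Longrightarrow> A t = normal_matrix (b t) (l t)"
    using N by (auto simp: normal_form_def)
  define f where
    "f i t = (vector [l t * b t, b t, inverse ((b t)\<^sup>2), b t, l t * b t] :: real^5) $ i" for i t
  define \<rho> where "\<rho> i = (vector [1, 1, 2, 3, 3] :: 3^5) $ i" for i
  have col: "column i (A t) = f i t *\<^sub>R axis (\<rho> i) 1" if "t \<in> I" for t i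
    using exhaust_5[of i]
    by (auto simp: A[OF that] f_def \<rho>_def normal_matrix_def column_def axis_def vec_eq_iff forall_3)
  have indep: "columns_independent_on I A"
    unfolding columns_independent_on_def
  proof (intro allI impI)
    fix x :: "5 \<Rightarrow> real" and i
    assume "\<forall>t\<in>I. (\<Sum>i\<in>UNIV. x i *\<^sub>R column i (A t)) = 0"
    then have *: "x 1 * (l t * b t) + x 2 * b t = 0" "x 3 * inverse ((b t)\<^sup>2) = 0"
        "x 4 * b t + x 5 * (l t * b t) = 0" if "t \<in> I" for t
      using that by (simp_all add: sum_5 col vec_eq_iff forall_3 axis_def f_def \<rho>_def)
    obtain s where s: "s \<in> I"
      using \<open>I \<noteq> {}\<close> by blast
    have zero: "p = 0 \<and> q = 0" if pq: "\<And>t. t \<in> I \<Longrightarrow> p * (l t * b t) + q * b t = 0" for p q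
    proof -
      have pl: "p * l t = - q" if "t \<in> I" for t
      proof -
        have "(p * l t + q) * b t = 0"
          using pq[OF that] by (simp add: algebra_simps)
        then show ?thesis
          using nz that by (simp add: eq_neg_iff_add_eq_0)
      qed
      have "((\<lambda>t. p * l t) has_real_derivative p * (d / (b s)\<^sup>2)) (at s)"
        using l s by (intro DERIV_cmult) blast
      moreover have "((\<lambda>t. p * l t) has_real_derivative 0) (at s)"
        by (rule has_field_derivative_transform_within_open[OF DERIV_const[of "- q"] \<open>open I\<close> s])
          (simp add: pl)
      ultimately have "p * (d / (b s)\<^sup>2) = 0"
        by (rule DERIV_unique)
      then have "p = 0"
        using \<open>d \<noteq> 0\<close> nz s by simp
      with pl[OF s] show ?thesis by simp
    qed
    have "x 1 = 0 \<and> x 2 = 0"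
      by (rule zero) (rule *(1))
    moreover have "x 5 = 0 \<and> x 4 = 0"
      by (rule zero) (simp add: *(3) add.commute)
    moreover have "x 3 = 0"
      using *(2)[OF s] nz s by simp
    ultimately show "x i = 0"
      using exhaust_5[of i] by metis
  qed
  have dets: "pdet A 2 3 4 t = 1 \<and>
        pdet A 1 2 3 t = 0 \<and> pdet A 3 4 5 t = 0 \<and> pdet A 2 3 5 t - pdet A 1 3 4 t = 0 \<and>
        pdet A 1 2 4 t = 0 \<and> pdet A 1 2 5 t = 0 \<and> pdet A 1 4 5 t = 0 \<and> pdet A 2 4 5 t = 0"
    if "t \<in> I" for t
    using nz that
    by (simp add: pdet_def col det3_scaleR f_def \<rho>_def)
      (simp add: det3_expand axis_def power2_eq_square field_simps)
  define c :: "nat \<Rightarrow> nat \<Rightarrow> real"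
    where "c i j = (if i = 1 \<and> j = 2 then d else if i = 4 \<and> j = 5 then - d else 0)" for i j
  have Q: "Qform A (of_nat i) (of_nat j) t = c i j" if "1 \<le> i" "i < j" "j \<le> 5" "t \<in> I" for i j t
  proof -
    obtain b' where b': "(b has_real_derivative b') (at t)"
      using b \<open>t \<in> I\<close> unfolding smooth_curve_on_def
      by (metis funpow_0 real_differentiable_def)
    define f' where "f' i = (vector [l t * b' + d / (b t)\<^sup>2 * b t, b',
        - (inverse ((b t)\<^sup>2) * (b t * b' + b' * b t) * inverse ((b t)\<^sup>2)),
        b', l t * b' + d / (b t)\<^sup>2 * b t] :: real^5) $ i" for i
    have lt: "(l has_real_derivative d / (b t)\<^sup>2) (at t)"
      using l \<open>t \<in> I\<close> by blast
    have bt: "b t \<noteq> 0"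
      using nz \<open>t \<in> I\<close> by blast
    have "((\<lambda>s. b s * b s) has_real_derivative b t * b' + b' * b t) (at t)"
      using DERIV_mult'[OF b' b'] by simp
    from DERIV_inverse'[OF this]
    have "((\<lambda>s. inverse ((b s)\<^sup>2)) has_real_derivative
        - (inverse ((b t)\<^sup>2) * (b t * b' + b' * b t) * inverse ((b t)\<^sup>2))) (at t)"
      using bt by (simp add: power2_eq_square)
    then have "(f i has_real_derivative f' i) (at t)" for i
      using exhaust_5[of i] b' DERIV_mult'[OF lt b']
      by (elim disjE) (simp_all add: f_def[abs_def] f'_def)
    from Qform_axis_columns[OF \<open>open I\<close> \<open>t \<in> I\<close> col this]
    have "Qform A (of_nat i) (of_nat j) t =
        (if \<rho> (of_nat i) = \<rho> (of_nat j)
         then f' (of_nat i) * f (of_nat j) t - f' (of_nat j) * f (of_nat i) t else 0)" .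
    moreover have "i = 1 \<or> i = 2 \<or> i = 3 \<or> i = 4" "j = 2 \<or> j = 3 \<or> j = 4 \<or> j = 5"
      using that by arith+
    ultimately show ?thesis
      using \<open>i < j\<close> bt
      by (elim disjE)
        (simp_all add: c_def \<rho>_def f_def f'_def, simp_all add: power2_eq_square field_simps)
  qed
  have "time_conditions I A c"
    unfolding time_conditions_def
    using smooth_normal_matrix[OF \<open>open I\<close> b nz l A] indep dets Q by (simp add: c_def)
  then show ?thesis
    by (intro exI[of _ c]) (simp add: c_def)
qed

section \<open>Reduction to the normal form\<close>

text \<open>
  The multiplier is \<open>\<ell> = p\<^sub>1\<^sub>3\<^sub>4\<close>.  It cannot be constant, for then columns 1 and 2 would
  be linearly dependent over the reals.
\<close>

lemma time_conditions_imp_multiplier: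
  assumes "open I" and T: "time_conditions I A c"
  shows "t \<in> I \<Longrightarrow> column 1 (A t) = pdet A 1 3 4 t *\<^sub>R column 2 (A t)"
    and "t \<in> I \<Longrightarrow> column 5 (A t) = pdet A 1 3 4 t *\<^sub>R column 4 (A t)"
    and "t \<in> I \<Longrightarrow> pdet A 1 3 4 differentiable at t"
    and "\<not> (\<exists>k. \<forall>t\<in>I. pdet A 1 3 4 t = k)"
proof -
  have smooth: "smooth_curve_on I A" and indep: "columns_independent_on I A"
    using T by (auto simp: time_conditions_def)
  have p: "pdet A 2 3 4 t = 1" "pdet A 1 2 3 t = 0" "pdet A 3 4 5 t = 0"
    "pdet A 2 3 5 t = pdet A 1 3 4 t" "pdet A 1 2 4 t = 0" "pdet A 2 4 5 t = 0" if "t \<in> I" for t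
    using T that by (auto simp: time_conditions_def)
  have nz: "column 2 (A t) \<noteq> 0" if "t \<in> I" for t
    using p(1)[OF that] by (auto simp: pdet_def det3_expand)
  have m: "column 1 (A t) = pdet A 1 3 4 t *\<^sub>R column 2 (A t)"
    "column 5 (A t) = pdet A 1 3 4 t *\<^sub>R column 4 (A t)" if "t \<in> I" for t
    using multiplier_of_determinants[OF p[OF that, unfolded pdet_def]] unfolding pdet_def by blast+
  show "t \<in> I \<Longrightarrow> column 1 (A t) = pdet A 1 3 4 t *\<^sub>R column 2 (A t)"
    and "t \<in> I \<Longrightarrow> column 5 (A t) = pdet A 1 3 4 t *\<^sub>R column 4 (A t)"
    by (fact m)+
  \<comment> \<open>The multiplier is also \<open>\<langle>A\<^sub>1, A\<^sub>2\<rangle> / \<langle>A\<^sub>2, A\<^sub>2\<rangle>\<close>, which is easier to differentiate than the determinant.\<close>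
  show "pdet A 1 3 4 differentiable at t" if t: "t \<in> I"
  proof -
    obtain D where "(A has_vector_derivative D) (at t)"
      using smooth t unfolding smooth_curve_on_def by (metis funpow_0 vector_derivative_works)
    note d = bounded_linear.has_vector_derivative[OF bounded_linear_column this]
    have inner_deriv: "((\<lambda>s. column i (A s) \<bullet> column j (A s)) has_real_derivative
        column i (A t) \<bullet> column j D + column i D \<bullet> column j (A t)) (at t)" for i j
      unfolding has_real_derivative_iff_has_vector_derivative
      by (rule bounded_bilinear.has_vector_derivative[OF bounded_bilinear_inner d d])
    have "column 2 (A t) \<bullet> column 2 (A t) \<noteq> 0"
      using nz[OF t] by simp
    from DERIV_divide[OF inner_deriv[of 1 2] inner_deriv[of 2 2] this]
    have "(pdet A 1 3 4 has_real_derivative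
        ((column 1 (A t) \<bullet> column 2 D + column 1 D \<bullet> column 2 (A t)) * (column 2 (A t) \<bullet> column 2 (A t)) -
         column 1 (A t) \<bullet> column 2 (A t) * (column 2 (A t) \<bullet> column 2 D + column 2 D \<bullet> column 2 (A t))) /
        (column 2 (A t) \<bullet> column 2 (A t) * (column 2 (A t) \<bullet> column 2 (A t)))) (at t)"
      by (rule has_field_derivative_transform_within_open[OF _ \<open>open I\<close> t]) (simp add: m(1) nz)
    then show ?thesis
      unfolding real_differentiable_def by blast
  qed
  show "\<not> (\<exists>k. \<forall>t\<in>I. pdet A 1 3 4 t = k)"
  proof
    assume "\<exists>k. \<forall>t\<in>I. pdet A 1 3 4 t = k"
    then obtain k where k: "\<And>t. t \<in> I \<Longrightarrow> pdet A 1 3 4 t = k" by blast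
    \<comment> \<open>This is the relation \<open>column 1 - k * column 2 = 0\<close>.\<close>
    define x :: "5 \<Rightarrow> real" where "x i = (vector [1, - k, 0, 0, 0] :: real^5) $ i" for i
    have "\<forall>t\<in>I. (\<Sum>i\<in>UNIV. x i *\<^sub>R column i (A t)) = 0"
      using m(1) k by (simp add: sum_5 x_def)
    then have "x 1 = 0"
      using indep unfolding columns_independent_on_def by blast
    then show False
      by (simp add: x_def)
  qed
qed

text \<open>
  Substituting \<open>A\<^sub>1 = \<ell> A\<^sub>2\<close> and \<open>A\<^sub>5 = \<ell> A\<^sub>4\<close> turns the forms \<open>Q\<^sub>1\<^sub>j\<close> and
  \<open>Q\<^sub>j\<^sub>5\<close> into \<open>\<ell> Q\<^sub>2\<^sub>j\<close> and \<open>\<ell> Q\<^sub>j\<^sub>4\<close> plus or minus \<open>\<ell>'\<close> times an inner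
  product.  So \<open>c\<^sub>1\<^sub>2 = \<ell>' |A\<^sub>2|\<^sup>2\<close>, and \<open>\<ell>'\<close> vanishes nowhere or everywhere; the latter
  is impossible as \<open>\<ell>\<close> is not constant.  The zeros among the \<open>c\<^sub>i\<^sub>j\<close> then give
  orthogonality of \<open>A\<^sub>3\<close> to \<open>A\<^sub>2\<close> and \<open>A\<^sub>4\<close>.  For \<open>A\<^sub>2\<close> and \<open>A\<^sub>4\<close>, the
  sum of the equations for \<open>c\<^sub>1\<^sub>4\<close> and \<open>c\<^sub>2\<^sub>5\<close> does not contain their inner
  product; it would determine \<open>\<ell>\<close> as a constant unless \<open>c\<^sub>2\<^sub>4 = 0\<close>.
\<close>

lemma time_conditions_imp_orthogonal:
  assumes "open I" "convex I" and T: "time_conditions I A c"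
  shows "t \<in> I \<Longrightarrow>
      (pdet A 1 3 4 has_real_derivative c 1 2 / (norm (column 2 (A t)))\<^sup>2) (at t)"
    and "c 1 2 \<noteq> 0" and "c 2 4 = 0"
    and "t \<in> I \<Longrightarrow> c 1 2 * (norm (column 4 (A t)))\<^sup>2 = - c 4 5 * (norm (column 2 (A t)))\<^sup>2"
    and "t \<in> I \<Longrightarrow> column 2 (A t) \<bullet> column 3 (A t) = 0"
    and "t \<in> I \<Longrightarrow> column 2 (A t) \<bullet> column 4 (A t) = 0"
    and "t \<in> I \<Longrightarrow> column 3 (A t) \<bullet> column 4 (A t) = 0"
proof -
  define l where "l = pdet A 1 3 4"
  note multiplier = time_conditions_imp_multiplier[OF \<open>open I\<close> T, folded l_def]
  note l1 = multiplier(1) and l5 = multiplier(2) and nonconst = multiplier(4)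
  obtain l' where l': "\<And>t. t \<in> I \<Longrightarrow> (l has_real_derivative l' t) (at t)"
    using multiplier(3) unfolding real_differentiable_def by metis
  have c0: "c 1 4 = 0" "c 1 3 = 0" "c 2 3 = 0" "c 3 4 = 0" "c 3 5 = 0"
    and Q: "\<And>i j t. 1 \<le> i \<Longrightarrow> i < j \<Longrightarrow> j \<le> 5 \<Longrightarrow> t \<in> I \<Longrightarrow>
      Qform A (of_nat i) (of_nat j) t = c i j"
    using T by (auto simp: time_conditions_def)
  have rel: "c 1 2 = l' t * (norm (column 2 (A t)))\<^sup>2"
    "c 4 5 = - l' t * (norm (column 4 (A t)))\<^sup>2"
    "l' t * (column 2 (A t) \<bullet> column 3 (A t)) = 0"
    "l' t * (column 3 (A t) \<bullet> column 4 (A t)) = 0"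
    "l' t * (column 2 (A t) \<bullet> column 4 (A t)) + l t * c 2 4 = 0"
    "c 2 5 = l t * c 2 4 - l' t * (column 2 (A t) \<bullet> column 4 (A t))"
    if t: "t \<in> I" for t
  proof -
    let ?a = "\<lambda>i s. column i (A s)"
    obtain D where D: "(A has_vector_derivative D) (at t)"
      using T t unfolding time_conditions_def smooth_curve_on_def
      by (metis funpow_0 vector_derivative_works)
    define d where "d j = column j D" for j
    have d: "(?a j has_vector_derivative d j) (at t)" for j
      unfolding d_def by (rule bounded_linear.has_vector_derivative[OF bounded_linear_column D])
    have scaled: "((\<lambda>s. l s *\<^sub>R ?a j s) has_vector_derivative l t *\<^sub>R d j + l' t *\<^sub>R ?a j t) (at t)" for j
      by (rule has_vector_derivative_scaleR[OF l'[OF t] d])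
    have D1: "(?a 1 has_vector_derivative l t *\<^sub>R d 2 + l' t *\<^sub>R ?a 2 t) (at t)"
      by (rule has_vector_derivative_transform_within_open[OF scaled[of 2] \<open>open I\<close> t]) (simp add: l1)
    have D5: "(?a 5 has_vector_derivative l t *\<^sub>R d 4 + l' t *\<^sub>R ?a 4 t) (at t)"
      by (rule has_vector_derivative_transform_within_open[OF scaled[of 4] \<open>open I\<close> t]) (simp add: l5)
    note at = l1[OF t] l5[OF t] inner_add_left inner_commute power2_norm_eq_inner algebra_simps
    note c = Q[where t = t, OF _ _ _ t]
    have q23: "d 2 \<bullet> ?a 3 t - d 3 \<bullet> ?a 2 t = 0"
      using c[of 2 3] c0 by (simp add: Qform_at[OF d d])
    have q34: "d 3 \<bullet> ?a 4 t - d 4 \<bullet> ?a 3 t = 0"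
      using c[of 3 4] c0 by (simp add: Qform_at[OF d d])
    have q24: "d 2 \<bullet> ?a 4 t - d 4 \<bullet> ?a 2 t = c 2 4"
      using c[of 2 4] by (simp add: Qform_at[OF d d])
    show "c 1 2 = l' t * (norm (?a 2 t))\<^sup>2"
      using c[of 1 2] by (simp add: Qform_at[OF D1 d] at)
    show "c 4 5 = - l' t * (norm (?a 4 t))\<^sup>2"
      using c[of 4 5] by (simp add: Qform_at[OF d D5] at)
    have "l' t * (?a 2 t \<bullet> ?a 3 t) + l t * (d 2 \<bullet> ?a 3 t - d 3 \<bullet> ?a 2 t) = 0"
      using c[of 1 3] c0 by (simp add: Qform_at[OF D1 d] at)
    then show "l' t * (?a 2 t \<bullet> ?a 3 t) = 0"
      by (simp add: q23)
    have "l t * (d 3 \<bullet> ?a 4 t - d 4 \<bullet> ?a 3 t) - l' t * (?a 3 t \<bullet> ?a 4 t) = 0"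
      using c[of 3 5] c0 by (simp add: Qform_at[OF d D5] at)
    then show "l' t * (?a 3 t \<bullet> ?a 4 t) = 0"
      by (simp add: q34)
    show "l' t * (?a 2 t \<bullet> ?a 4 t) + l t * c 2 4 = 0"
      using c[of 1 4] c0 unfolding q24[symmetric] by (simp add: Qform_at[OF D1 d] at)
    show "c 2 5 = l t * c 2 4 - l' t * (?a 2 t \<bullet> ?a 4 t)"
      using c[of 2 5] unfolding q24[symmetric] by (simp add: Qform_at[OF d D5] at)
  qed
  have c12: "c 1 2 \<noteq> 0"
  proof
    assume "c 1 2 = 0"
    moreover have "column 2 (A t) \<noteq> 0" if "t \<in> I" for t
      using T that by (auto simp: time_conditions_def pdet_def det3_expand)
    ultimately have "l' t = 0" if "t \<in> I" for t
      using rel(1)[OF that] that by simp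
    then have "(l has_real_derivative 0) (at t within I)" if "t \<in> I" for t
      using l'[OF that] that by (metis has_field_derivative_at_within)
    from has_field_derivative_zero_constant[OF \<open>convex I\<close> this] nonconst show False
      by blast
  qed
  have l'nz: "l' t \<noteq> 0" if "t \<in> I" for t
    using c12 rel(1)[OF that] by auto
  \<comment> \<open>Eliminating the inner product from the last two relations leaves \<open>c 2 5 = 2 * l t * c 2 4\<close>.\<close>
  have c24: "c 2 4 = 0"
  proof (rule ccontr)
    assume nz: "c 2 4 \<noteq> 0"
    have "l t = c 2 5 / (2 * c 2 4)" if "t \<in> I" for t
      using rel(5,6)[OF that] nz by (simp add: field_simps)
    with nonconst show False by blast
  qed
  show "c 1 2 \<noteq> 0" and "c 2 4 = 0"
    by (fact c12, fact c24)
  assume t: "t \<in> I"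
  show "(pdet A 1 3 4 has_real_derivative c 1 2 / (norm (column 2 (A t)))\<^sup>2) (at t)"
    using l'[OF t] c12 rel(1)[OF t] unfolding l_def
    by (metis mult_eq_0_iff nonzero_mult_div_cancel_right)
  show "c 1 2 * (norm (column 4 (A t)))\<^sup>2 = - c 4 5 * (norm (column 2 (A t)))\<^sup>2"
    unfolding rel(1,2)[OF t] by simp
  show "column 2 (A t) \<bullet> column 3 (A t) = 0" "column 2 (A t) \<bullet> column 4 (A t) = 0"
    "column 3 (A t) \<bullet> column 4 (A t) = 0"
    using rel(3-5)[OF t] l'nz[OF t] c24 by simp_all
qed

text \<open>
  Every form \<open>Q\<^sub>i\<^sub>j\<close> among \<open>A\<^sub>2, A\<^sub>3, A\<^sub>4\<close> vanishes, so the derivative of each of these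
  columns is orthogonal to the other two and thus parallel to the column itself.
\<close>

lemma constant_directions:
  assumes "open I" "convex I" and T: "time_conditions I A c"
    and o23: "\<And>t. t \<in> I \<Longrightarrow> column 2 (A t) \<bullet> column 3 (A t) = 0"
    and o24: "\<And>t. t \<in> I \<Longrightarrow> column 2 (A t) \<bullet> column 4 (A t) = 0"
    and o34: "\<And>t. t \<in> I \<Longrightarrow> column 3 (A t) \<bullet> column 4 (A t) = 0"
    and c24: "c 2 4 = 0"
    and j: "j \<in> {2, 3, 4}"
  obtains e where "\<And>t. t \<in> I \<Longrightarrow> sgn (column j (A t)) = e"
proof -
  let ?a = "\<lambda>i s. column i (A s)"
  have det: "det3 (?a 2 t) (?a 3 t) (?a 4 t) = 1" if "t \<in> I" for t
    using T that by (auto simp: time_conditions_def pdet_def)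
  have nz: "?a j t \<noteq> 0" if "t \<in> I" for t
    using det[OF that] j by (auto simp: det3_expand)
  have "\<exists>m. (?a j has_vector_derivative m *\<^sub>R ?a j t) (at t)" if t: "t \<in> I" for t
  proof -
    obtain D where D: "(A has_vector_derivative D) (at t)"
      using T t unfolding time_conditions_def smooth_curve_on_def
      by (metis funpow_0 vector_derivative_works)
    define d where "d j = column j D" for j
    have d: "(?a j has_vector_derivative d j) (at t)" for j
      unfolding d_def by (rule bounded_linear.has_vector_derivative[OF bounded_linear_column D])
    have "Qform A (of_nat 2) (of_nat 3) t = c 2 3" "Qform A (of_nat 2) (of_nat 4) t = c 2 4"
      "Qform A (of_nat 3) (of_nat 4) t = c 3 4" "c 2 3 = 0" "c 3 4 = 0"
      using T t by (auto simp: time_conditions_def simp del: of_nat_numeral)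
    then have Q: "d 2 \<bullet> ?a 3 t - d 3 \<bullet> ?a 2 t = 0" "d 2 \<bullet> ?a 4 t - d 4 \<bullet> ?a 2 t = 0"
      "d 3 \<bullet> ?a 4 t - d 4 \<bullet> ?a 3 t = 0"
      using c24 by (simp_all add: Qform_at[OF d d])
    note orth = orthogonal_curves_derivatives[OF \<open>open I\<close> t o23 d d Q(1)]
      orthogonal_curves_derivatives[OF \<open>open I\<close> t o24 d d Q(2)]
      orthogonal_curves_derivatives[OF \<open>open I\<close> t o34 d d Q(3)]
    have inner0: "?a 2 t \<bullet> ?a 3 t = 0" "?a 2 t \<bullet> ?a 4 t = 0" "?a 3 t \<bullet> ?a 4 t = 0"
      "?a 3 t \<bullet> ?a 2 t = 0" "?a 4 t \<bullet> ?a 2 t = 0" "?a 4 t \<bullet> ?a 3 t = 0"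
      using o23[OF t] o24[OF t] o34[OF t] by (simp_all add: inner_commute)
    have dets: "det3 (?a 2 t) (?a 3 t) (?a 4 t) \<noteq> 0" "det3 (?a 3 t) (?a 2 t) (?a 4 t) \<noteq> 0"
      "det3 (?a 4 t) (?a 2 t) (?a 3 t) \<noteq> 0"
      using det[OF t] by (simp_all add: det3_expand)
    have "\<exists>m. d j = m *\<^sub>R ?a j t"
      using j
        orthogonal_to_two_frame_vectors[OF dets(1) inner0(1,2) orth(1,3)]
        orthogonal_to_two_frame_vectors[OF dets(2) inner0(4,3) orth(2,5)]
        orthogonal_to_two_frame_vectors[OF dets(3) inner0(5,6) orth(4,6)]
      by blast
    then show ?thesis
      using d[of j] by auto
  qed
  then obtain m where "\<And>t. t \<in> I \<Longrightarrow> (?a j has_vector_derivative m t *\<^sub>R ?a j t) (at t)"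
    by metis
  from constant_direction[OF \<open>convex I\<close> this nz] that show thesis
    by blast
qed

text \<open>
  The rows of the rotation are the constant directions of \<open>A\<^sub>2, A\<^sub>3, A\<^sub>4\<close>.  The ratio
  \<open>k = |A\<^sub>4| / |A\<^sub>2|\<close> is constant, since \<open>c\<^sub>1\<^sub>2\<close> and \<open>- c\<^sub>4\<^sub>5\<close> are
  \<open>\<ell>'\<close> times the squares of the two lengths; the columns are rescaled to remove it.
\<close>

lemma time_conditions_imp_normal_form:
  assumes "open I" "I \<noteq> {}" "convex I" and T: "time_conditions I A c"
  obtains R h b l where "rotation_matrix R" "\<forall>i. h i \<noteq> 0" "h 1 * h 4 = h 2 * h 5"
    "normal_form I b l (c 1 2) (\<lambda>t. R ** A t ** diag_matrix h)"
proof -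
  let ?a = "\<lambda>i s. column i (A s)"
  define l where "l = pdet A 1 3 4"
  note multiplier = time_conditions_imp_multiplier[OF \<open>open I\<close> T, folded l_def]
  note l1 = multiplier(1) and l5 = multiplier(2)
  note orthogonal = time_conditions_imp_orthogonal[OF \<open>open I\<close> \<open>convex I\<close> T, folded l_def]
  note l' = orthogonal(1) and c12 = orthogonal(2) and c24 = orthogonal(3) and norm4 = orthogonal(4)
    and o23 = orthogonal(5) and o24 = orthogonal(6) and o34 = orthogonal(7)
  note dir = constant_directions[OF \<open>open I\<close> \<open>convex I\<close> T o23 o24 o34 c24]
  obtain e2 where e2: "\<And>t. t \<in> I \<Longrightarrow> sgn (?a 2 t) = e2"
    using dir[of 2] by blast
  obtain e3 where e3: "\<And>t. t \<in> I \<Longrightarrow> sgn (?a 3 t) = e3"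
    using dir[of 3] by blast
  obtain e4 where e4: "\<And>t. t \<in> I \<Longrightarrow> sgn (?a 4 t) = e4"
    using dir[of 4] by blast
  have det: "det3 (?a 2 t) (?a 3 t) (?a 4 t) = 1" if "t \<in> I" for t
    using T that by (auto simp: time_conditions_def pdet_def)
  have nz: "?a 2 t \<noteq> 0" "?a 3 t \<noteq> 0" "?a 4 t \<noteq> 0" if "t \<in> I" for t
    using det[OF that] by (auto simp: det3_expand)
  define R :: "real^3^3" where "R = vector [e2, e3, e4]"
  define b where "b t = norm (?a 2 t)" for t
  have rot: "rotation_matrix R"
    and vol: "b t * norm (?a 3 t) * norm (?a 4 t) = 1" if t: "t \<in> I" for t
    using rotation_matrix_of_orthogonal_frame[of "?a 2 t" "?a 3 t" "?a 4 t"]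
      det[OF t] o23[OF t] o24[OF t] o34[OF t] e2[OF t] e3[OF t] e4[OF t]
    by (simp_all add: R_def b_def)
  \<comment> \<open>By the relation between the squared lengths this is the ratio of the lengths of columns 4 and 2.\<close>
  define k where "k = sqrt (- c 4 5 / c 1 2)"
  have b0: "b t > 0" if "t \<in> I" for t
    using nz[OF that] by (simp add: b_def)
  have n4: "norm (?a 4 t) = k * b t" if t: "t \<in> I" for t
  proof -
    have "(norm (?a 4 t))\<^sup>2 = (- c 4 5 / c 1 2) * (b t)\<^sup>2"
      using norm4[OF t] c12 by (simp add: b_def field_simps)
    from arg_cong[OF this, of sqrt] show ?thesis
      using b0[OF t] by (simp only: real_sqrt_mult k_def) simp
  qed
  obtain s where s: "s \<in> I"
    using \<open>I \<noteq> {}\<close> by blast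
  have k0: "k \<noteq> 0"
    using n4[OF s] nz(3)[OF s] by auto
  \<comment> \<open>The box spanned by columns 2, 3, 4 has volume 1.\<close>
  have n3: "norm (?a 3 t) = inverse (k * (b t)\<^sup>2)" if t: "t \<in> I" for t
    using vol[OF t] n4[OF t] k0 b0[OF t] by (simp add: field_simps power2_eq_square)
  \<comment> \<open>The lengths of columns 2, 3, 4 become \<open>b\<close>, \<open>1 / b\<^sup>2\<close>, \<open>b\<close>.\<close>
  define h where "h i = (vector [1, 1, k, inverse k, inverse k] :: real^5) $ i" for i
  have entry: "(R ** M ** diag_matrix h) $ i $ j = (R $ i \<bullet> column j M) * h j" for M :: "real^5^3" and i j
    unfolding mult_diag_matrix by (simp add: matrix_matrix_mult_def inner_vec_def column_def)
  have polar: "e2 \<bullet> ?a 2 t = b t" "e3 \<bullet> ?a 3 t = inverse (k * (b t)\<^sup>2)" "e4 \<bullet> ?a 4 t = k * b t"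
    "e2 \<bullet> ?a 3 t = 0" "e2 \<bullet> ?a 4 t = 0" "e3 \<bullet> ?a 2 t = 0"
    "e3 \<bullet> ?a 4 t = 0" "e4 \<bullet> ?a 2 t = 0" "e4 \<bullet> ?a 3 t = 0" if t: "t \<in> I" for t
  proof -
    have sg: "sgn x \<bullet> x = norm x" for x :: "real^3"
      by (cases "x = 0") (simp_all add: sgn_div_norm power2_norm_eq_inner[symmetric] power2_eq_square)
    show "e2 \<bullet> ?a 2 t = b t" "e3 \<bullet> ?a 3 t = inverse (k * (b t)\<^sup>2)" "e4 \<bullet> ?a 4 t = k * b t"
      using sg[of "?a 2 t"] sg[of "?a 3 t"] sg[of "?a 4 t"] n3[OF t] n4[OF t]
      by (simp_all add: e2[OF t] e3[OF t] e4[OF t] b_def)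
    show "e2 \<bullet> ?a 3 t = 0" "e2 \<bullet> ?a 4 t = 0" "e3 \<bullet> ?a 2 t = 0"
      "e3 \<bullet> ?a 4 t = 0" "e4 \<bullet> ?a 2 t = 0" "e4 \<bullet> ?a 3 t = 0"
      unfolding e2[OF t, symmetric] e3[OF t, symmetric] e4[OF t, symmetric]
      using o23[OF t] o24[OF t] o34[OF t] by (simp_all add: sgn_div_norm inner_commute)
  qed
  have "R ** A t ** diag_matrix h = normal_matrix (b t) (l t)" if t: "t \<in> I" for t
    unfolding vec_eq_iff forall_3 forall_5 entry
    using k0 by (simp add: R_def h_def normal_matrix_def l1[OF t] l5[OF t] polar[OF t])
  moreover have "smooth_curve_on I b"
    unfolding smooth_curve_on_iff_diff_order[OF \<open>open I\<close>]
  proof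
    fix n
    have "diff_order I n A"
      using T smooth_curve_on_iff_diff_order[OF \<open>open I\<close>] by (auto simp: time_conditions_def)
    \<comment> \<open>The direction of column 2 is constant, so its length is a fixed linear functional of it.\<close>
    then have "diff_order I n (\<lambda>t. e2 \<bullet> ?a 2 t)"
      by (intro diff_order_bounded_linear[OF bounded_linear_inner_right]
          diff_order_bounded_linear[OF bounded_linear_column])
    then show "diff_order I n b"
      by (rule diff_order_cong[OF \<open>open I\<close>, rotated]) (simp add: polar)
  qed
  ultimately have "normal_form I b l (c 1 2) (\<lambda>t. R ** A t ** diag_matrix h)"
    unfolding normal_form_def using b0 c12 l' by (force simp: b_def)
  moreover have "h i \<noteq> 0" for i
    using exhaust_5[of i] k0 by (auto simp: h_def)
  moreover have "h 1 * h 4 = h 2 * h 5"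
    by (simp add: h_def)
  ultimately show thesis
    using that rot[OF s] by blast
qed

theorem theorem5p5:
  fixes I :: "real set"
  assumes "open I" and "is_interval I" and "I \<noteq> {}"
  shows "(\<forall>A c. time_conditions I A c \<longrightarrow>
            (\<exists>(R :: real^3^3) (H :: real^5^5) c' b l.
               rotation_matrix R \<and> diagonal H \<and> invertible H \<and>
               preserves_spatial_constraints H \<and>
               time_conditions I (\<lambda>t. R ** A t ** H) c' \<and>
               normal_form I b l (c' 1 2) (\<lambda>t. R ** A t ** H)))
       \<and> (\<forall>A b l d. normal_form I b l d A \<longrightarrow>
            (\<exists>c. c 1 2 = d \<and> time_conditions I A c))"
proof (intro conjI allI impI)
  fix A c
  assume T: "time_conditions I A c"
  have "convex I"
    using \<open>is_interval I\<close> by (rule is_interval_convex)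
  obtain R h b l where R: "rotation_matrix R" and h: "\<forall>i. h i \<noteq> 0" "h 1 * h 4 = h 2 * h 5"
    and N: "normal_form I b l (c 1 2) (\<lambda>t. R ** A t ** diag_matrix h)"
    by (rule time_conditions_imp_normal_form[OF \<open>open I\<close> \<open>I \<noteq> {}\<close> \<open>convex I\<close> T])
  obtain c' where c': "c' 1 2 = c 1 2" "time_conditions I (\<lambda>t. R ** A t ** diag_matrix h) c'"
    using normal_form_imp_time_conditions[OF \<open>open I\<close> \<open>I \<noteq> {}\<close> N] by blast
  have "invertible (diag_matrix h)" "preserves_spatial_constraints (diag_matrix h)"
    using h by (simp_all add: diag_matrix_inverse(1) diagonal_rescaling_preserves_spatial_constraints)
  with R c' N show "\<exists>(R :: real^3^3) (H :: real^5^5) c' b l.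
          rotation_matrix R \<and> diagonal H \<and> invertible H \<and>
          preserves_spatial_constraints H \<and>
          time_conditions I (\<lambda>t. R ** A t ** H) c' \<and>
          normal_form I b l (c' 1 2) (\<lambda>t. R ** A t ** H)"
    by (intro exI[of _ R] exI[of _ "diag_matrix h"] exI[of _ c'] exI[of _ b] exI[of _ l])
      (simp add: diagonal_diag_matrix)
next
  show "\<exists>c. c 1 2 = d \<and> time_conditions I A c" if "normal_form I b l d A" for A b l d
    by (rule normal_form_imp_time_conditions[OF \<open>open I\<close> \<open>I \<noteq> {}\<close> that])
qed

end
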